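(* Let $k\ge2$ be an integer, let $X_1,\dots,X_k,L\in[1,\infty)$ with $L\ge\max(X_1,\dots,X_k)$, and let $\delta\in(0,1]$. Let $A_i\subset[X_i,2X_i]$ ($1\le i\le k$) be sets of integers such that $\operatorname{lcm}(a_1,\dots,a_k)\le L$ for at least $\delta\prod_{i=1}^k|A_i|$ tuples $(a_1,\dots,a_k)\in\prod_{i=1}^kA_i$. Then for every fixed $\varepsilon\in(0,1)$, $$\prod_{i=1}^k|A_i|\ll_{k,\varepsilon}\delta^{-\frac{k}{k-1}}\,\frac{L^{\frac{k}{k-1}+\varepsilon}}{\left(\prod_{i=1}^kX_i\right)^{\frac1{k-1}}},$$ where the implied constant depends only on $k$ and $\varepsilon$. *)

theory Defs
  imports Complex_Main "HOL-Library.FuncSet"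
begin

end

theory Submission
  imports Defs "HOL-Computational_Algebra.Primes"
begin

text \<open>
  If a tuple has least common multiple \<open>n \<le> L\<close>, then \<open>n\<close> is a multiple of \<open>a\<^sub>i\<close> and every
  \<open>a\<^sub>j\<close> divides \<open>n\<close>. So for each fixed \<open>i\<close> the divisor bound gives at most
  \<open>\<bar>A\<^sub>i\<bar> (L / X\<^sub>i) L\<^sup>o\<^sup>(\<^sup>1\<^sup>)\<close> such tuples. With
  \<open>P = \<Prod>\<bar>A\<^sub>i\<bar>\<close>, multiplying these \<open>k\<close> bounds for the same quantity, which is at least
  \<open>\<delta> P\<close>, bounds \<open>(\<delta> P)\<^sup>k\<close> by \<open>P L\<^sup>k\<^sup>+\<^sup>o\<^sup>(\<^sup>1\<^sup>) / \<Prod>X\<^sub>i\<close>; it remains to cancel one factor \<open>P\<close> and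
  take the \<open>(k - 1)\<close>-th root.
\<close>

section \<open>The divisor bound: the number of divisors of \<open>n\<close> is at most a constant
  times \<open>n powr \<eta>\<close>\<close>

text \<open>With \<open>t = \<eta> * ln 2\<close>, the number \<open>p ^ a\<close> to the power
  \<open>\<eta>\<close> is at least \<open>exp (a * t) \<ge> 1 + a * t\<close>, and the factor
  \<open>1 + 1 / t\<close> turns \<open>a * t\<close> into at least \<open>a\<close>. The loss
  depends neither on \<open>p\<close> nor on \<open>a\<close>.\<close>

lemma Suc_le_powr:
  fixes \<eta> :: real
  assumes "0 < \<eta>" "p \<ge> 2"
  shows "real (Suc a) \<le> (1 + 1 / (\<eta> * ln 2)) * real (p ^ a) powr \<eta>"
proof -
  define t where "t = \<eta> * ln 2"
  have t: "t > 0" using assms by (simp add: t_def)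
  have "exp (real a * t) \<le> real (p ^ a) powr \<eta>"
  proof -
    have "exp (real a * t) = (2 ^ a) powr \<eta>"
      by (simp add: powr_def ln_realpow t_def mult_ac)
    also have "\<dots> \<le> real (p ^ a) powr \<eta>"
      using assms by (intro powr_mono2) (auto intro: power_mono)
    finally show ?thesis .
  qed
  moreover have "real (Suc a) \<le> (1 + 1 / t) * exp (real a * t)"
  proof -
    have "real (Suc a) \<le> (1 + 1 / t) * (1 + real a * t)"
      using t by (simp add: field_simps)
    also have "\<dots> \<le> (1 + 1 / t) * exp (real a * t)"
      using t by (intro mult_left_mono exp_ge_add_one_self) auto
    finally show ?thesis .
  qed
  ultimately show ?thesis
    using t mult_left_mono[of "exp (real a * t)" "real (p ^ a) powr \<eta>" "1 + 1 / t"]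
    unfolding t_def[symmetric] by simp
qed

text \<open>For such \<open>p\<close> already \<open>p powr \<eta> \<ge> 2\<close>, and
  \<open>2 ^ a \<ge> a + 1\<close>; large primes thus cost no constant.\<close>

lemma Suc_le_powr_large:
  fixes \<eta> :: real
  assumes "0 < \<eta>" "real p \<ge> 2 powr (1 / \<eta>)"
  shows "real (Suc a) \<le> real (p ^ a) powr \<eta>"
proof -
  have "2 = (2 powr (1 / \<eta>)) powr \<eta>"
    using assms by (simp add: powr_powr)
  also have "\<dots> \<le> real p powr \<eta>"
    using assms by (intro powr_mono2) auto
  finally have "2 ^ a \<le> (real p powr \<eta>) ^ a"
    by (intro power_mono) auto
  also have "\<dots> = real (p ^ a) powr \<eta>"
    by (induction a) (simp_all add: powr_mult)
  finally have "2 ^ a \<le> real (p ^ a) powr \<eta>" .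
  moreover have "real (Suc a) \<le> 2 ^ a"
    by (metis Suc_leI less_exp of_nat_le_iff of_nat_numeral of_nat_power)
  ultimately show ?thesis by linarith
qed

text \<open>The map \<open>(i, d)\<close> to \<open>p ^ i * d\<close> reaches every divisor; it may
  fail to be injective when \<open>p\<close> divides \<open>m\<close>, hence an inequality.\<close>

lemma card_divisors_prime_power_mult_le:
  fixes m p a :: nat
  assumes "prime p" "m > 0"
  shows "card {d. d dvd p ^ a * m} \<le> Suc a * card {d. d dvd m}"
proof -
  have "{d. d dvd p ^ a * m} \<subseteq> (\<lambda>(i, d). p ^ i * d) ` ({..a} \<times> {d. d dvd m})"
  proof
    fix d assume "d \<in> {d. d dvd p ^ a * m}"
    then obtain b c where "d = b * c" "b dvd p ^ a" "c dvd m"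
      using division_decomp by blast
    moreover obtain i where "i \<le> a" "b = p ^ i"
      using \<open>b dvd p ^ a\<close> divides_primepow_nat[OF assms(1)] by blast
    ultimately show "d \<in> (\<lambda>(i, d). p ^ i * d) ` ({..a} \<times> {d. d dvd m})"
      by force
  qed
  then have "card {d. d dvd p ^ a * m} \<le> card ({..a} \<times> {d. d dvd m})"
    using assms by (intro surj_card_le) auto
  then show ?thesis
    by (simp add: card_cartesian_product)
qed

text \<open>
  Only the primes below \<open>2 powr (1 / \<eta>)\<close> cost a factor \<open>K\<close>, so that the constant in the
  divisor bound does not depend on \<open>n\<close>.
\<close>

lemma card_divisors_le_power_small_primes:
  fixes \<eta> K :: real and n N :: nat
  assumes "0 < \<eta>" "1 + 1 / (\<eta> * ln 2) \<le> K" "2 powr (1 / \<eta>) \<le> real N" "n > 0"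
  shows "real (card {d. d dvd n}) \<le> K ^ card {p. prime p \<and> p dvd n \<and> p \<le> N} * real n powr \<eta>"
  using \<open>n > 0\<close>
proof (induction n rule: less_induct)
  case (less n)
  let ?c = "\<lambda>n. card {p. prime p \<and> p dvd n \<and> p \<le> N}"
  have K: "K \<ge> 1"
    using assms(1,2) by (smt (verit) divide_nonneg_pos ln_gt_zero mult_pos_pos)
  show ?case
  proof (cases "n = 1")
    case True
    then show ?thesis using K by simp
  next
    case False
    then obtain p where p: "prime p" "p dvd n"
      using prime_factor_nat by blast
    \<comment> \<open>Removing the full power of \<open>p\<close> makes the count of small primes
      drop by exactly one if \<open>p \<le> N\<close>, and stay the same otherwise.\<close>
    obtain a m where am: "n = p ^ a * m" "\<not> p dvd m"
      using multiplicity_decompose'[of n p] p less.prems not_prime_unit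
      by (metis less_irrefl_nat)
    have a: "a > 0"
      using p am by (cases a) auto
    have m: "0 < m" "m < n"
    proof -
      show "0 < m" using less.prems am by (cases m) auto
      moreover have "1 < p ^ a" using one_less_power[OF prime_gt_1_nat[OF p(1)] a] .
      ultimately show "m < n" by (simp add: am(1))
    qed
    have fin: "finite {q. prime q \<and> q dvd m \<and> q \<le> N}"
      by (rule finite_subset[of _ "{..N}"]) auto
    have dvd_n: "q dvd n \<longleftrightarrow> q = p \<or> q dvd m" if "prime q" for q
      using that p(1) a primes_dvd_imp_eq[of q p]
      by (auto simp: am(1) prime_dvd_mult_iff prime_dvd_power_iff)
    \<comment> \<open>The factor \<open>Suc a\<close> is absorbed by \<open>p ^ a\<close> to the
      power \<open>\<eta>\<close>, together with one new factor \<open>K\<close> when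
      \<open>p \<le> N\<close>.\<close>
    have step: "real (Suc a) * K ^ ?c m \<le> K ^ ?c n * real (p ^ a) powr \<eta>"
    proof (cases "p \<le> N")
      case True
      have "{q. prime q \<and> q dvd n \<and> q \<le> N} = insert p {q. prime q \<and> q dvd m \<and> q \<le> N}"
        using p True dvd_n by auto
      then have c: "?c n = Suc (?c m)"
        using am(2) fin by simp
      have "real (Suc a) \<le> (1 + 1 / (\<eta> * ln 2)) * real (p ^ a) powr \<eta>"
        using assms(1) prime_ge_2_nat[OF p(1)] by (rule Suc_le_powr)
      also have "\<dots> \<le> K * real (p ^ a) powr \<eta>"
        using assms(2) by (intro mult_right_mono) auto
      finally have "real (Suc a) * K ^ ?c m \<le> (K * real (p ^ a) powr \<eta>) * K ^ ?c m"
        using K by (intro mult_right_mono) auto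
      then show ?thesis unfolding c by (simp add: mult_ac)
    next
      case False
      have "{q. prime q \<and> q dvd n \<and> q \<le> N} = {q. prime q \<and> q dvd m \<and> q \<le> N}"
        using False dvd_n by auto
      then have c: "?c n = ?c m" by simp
      have "real (Suc a) \<le> real (p ^ a) powr \<eta>"
        using assms(1,3) False by (intro Suc_le_powr_large) auto
      then have "real (Suc a) * K ^ ?c m \<le> real (p ^ a) powr \<eta> * K ^ ?c m"
        using K by (intro mult_right_mono) auto
      then show ?thesis unfolding c by (simp add: mult_ac)
    qed
    have "real (card {d. d dvd n}) \<le> real (Suc a * card {d. d dvd m})"
      unfolding am(1) using card_divisors_prime_power_mult_le[OF p(1) m(1)] of_nat_mono by blast
    also have "\<dots> \<le> real (Suc a) * (K ^ ?c m * real m powr \<eta>)"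
      unfolding of_nat_mult using less.IH[OF m(2,1)] by (intro mult_left_mono) auto
    also have "\<dots> \<le> K ^ ?c n * real (p ^ a) powr \<eta> * real m powr \<eta>"
      using mult_right_mono[OF step, of "real m powr \<eta>"] by (simp add: mult_ac)
    also have "\<dots> = K ^ ?c n * real n powr \<eta>"
      unfolding am(1) by (simp add: powr_mult mult_ac)
    finally show ?thesis .
  qed
qed

text \<open>At most \<open>N\<close> primes are small, so their total cost is at most
  \<open>K ^ N\<close>, where \<open>K\<close> and \<open>N\<close> depend on \<open>\<eta>\<close>
  only.\<close>

lemma divisor_bound:
  fixes \<eta> :: real
  assumes "0 < \<eta>"
  obtains C :: real where "C \<ge> 1"
    "\<And>n::nat. n > 0 \<Longrightarrow> real (card {d. d dvd n}) \<le> C * real n powr \<eta>"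
proof -
  define N where "N = nat \<lceil>2 powr (1 / \<eta>)\<rceil>"
  define K where "K = 1 + 1 / (\<eta> * ln 2)"
  have N: "2 powr (1 / \<eta>) \<le> real N" by (simp add: N_def real_nat_ceiling_ge)
  have K: "K \<ge> 1" using assms by (simp add: K_def)
  have "real (card {d. d dvd n}) \<le> K ^ N * real n powr \<eta>" if "n > 0" for n :: nat
  proof -
    have "card {p. prime p \<and> p dvd n \<and> p \<le> N} \<le> card {1..N}"
      by (intro card_mono) (auto dest: prime_ge_1_nat)
    then have "K ^ card {p. prime p \<and> p dvd n \<and> p \<le> N} \<le> K ^ N"
      using K by (intro power_increasing) auto
    then show ?thesis
      by (intro order_trans[OF card_divisors_le_power_small_primes[OF assms _ N that, of K]] mult_right_mono)
        (simp_all add: K_def)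
  qed
  then show ?thesis using that[of "K ^ N"] K by simp
qed

section \<open>Counting tuples with bounded least common multiple\<close>

lemma card_pos_int_divisors:
  assumes "(n::int) > 0"
  shows "finite {d::int. 0 < d \<and> d dvd n}"
    "card {d::int. 0 < d \<and> d dvd n} = card {d::nat. d dvd nat n}"
proof -
  have eq: "{d::int. 0 < d \<and> d dvd n} = int ` {d. d dvd nat n}"
  proof (intro equalityI subsetI)
    fix d assume "d \<in> {d::int. 0 < d \<and> d dvd n}"
    then have "d = int (nat d)" "nat d dvd nat n"
      using assms by (auto simp: nat_dvd_iff)
    then show "d \<in> int ` {d. d dvd nat n}" by blast
  next
    fix d assume "d \<in> int ` {d. d dvd nat n}"
    then obtain e where "d = int e" "e dvd nat n" by blast
    moreover from this have "e > 0" using assms by (auto intro!: Nat.gr0I)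
    ultimately show "d \<in> {d::int. 0 < d \<and> d dvd n}"
      using assms by (auto simp flip: int_dvd_int_iff)
  qed
  show "finite {d::int. 0 < d \<and> d dvd n}"
    unfolding eq using assms by (intro finite_imageI finite_divisors_nat) auto
  show "card {d::int. 0 < d \<and> d dvd n} = card {d::nat. d dvd nat n}"
    unfolding eq by (intro card_image) auto
qed

text \<open>The entry \<open>b = a i\<close> and the cofactor \<open>m\<close> determine the least
  common multiple \<open>b * m\<close>. Since \<open>b \<ge> x\<close>, there are at most
  \<open>L / x\<close> cofactors for each \<open>b\<close>, and every entry is then one of at most
  \<open>D\<close> divisors of \<open>b * m\<close>.\<close>

lemma card_Lcm_le_tuples:
  fixes A :: "'i \<Rightarrow> int set" and x L D :: real
  assumes I: "finite I" "i \<in> I" and fin: "finite (A i)"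
    and pos: "\<And>j a. j \<in> I \<Longrightarrow> a \<in> A j \<Longrightarrow> a > 0"
    and x: "x > 0" "\<And>a. a \<in> A i \<Longrightarrow> x \<le> real_of_int a" and L: "L \<ge> 0" and "D \<ge> 0"
    and D: "\<And>n. n > 0 \<Longrightarrow> real n \<le> L \<Longrightarrow> real (card {d. d dvd n}) \<le> D"
  shows "real (card {a \<in> PiE I A. real_of_int (Lcm (a ` I)) \<le> L})
           \<le> real (card (A i)) * (L / x) * D ^ card I"
proof -
  define S where "S = {a \<in> PiE I A. real_of_int (Lcm (a ` I)) \<le> L}"
  \<comment> \<open>The condition \<open>b * m \<le> L\<close> is kept so that the divisor bound
    \<open>D\<close> applies to \<open>b * m\<close>.\<close>
  define B where "B = {(b, m) \<in> A i \<times> {1..\<lfloor>L / x\<rfloor>}. real_of_int (b * m) \<le> L}"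
  \<comment> \<open>Only divisibility is retained, and even entry \<open>i\<close> is left free.
    This overcounts by a harmless factor \<open>D\<close> but makes \<open>F\<close> a plain
    product.\<close>
  define F where "F = (\<lambda>(b::int, m). PiE I (\<lambda>_. {d::int. 0 < d \<and> d dvd b * m}))"
  have posB: "b * m > 0" if "(b, m) \<in> B" for b m
    using that pos[OF I(2)] by (auto simp: B_def)
  have finB: "finite B"
    by (rule finite_subset[of _ "A i \<times> {1..\<lfloor>L / x\<rfloor>}"]) (auto simp: B_def fin)
  have "S \<subseteq> (\<Union>z\<in>B. F z)"
  proof
    fix a assume a: "a \<in> S"
    then have aA: "\<And>j. j \<in> I \<Longrightarrow> a j \<in> A j" and ext: "a \<in> extensional I"
      and le: "real_of_int (Lcm (a ` I)) \<le> L"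
      by (auto simp: S_def PiE_def)
    define n where "n = Lcm (a ` I)"
    have "0 \<notin> a ` I" using aA pos by force
    then have "n \<noteq> 0" unfolding n_def using I(1) by (simp add: Lcm_0_iff)
    moreover have "n \<ge> 0" by (simp add: n_def)
    ultimately have n: "n > 0" by simp
    have "a i dvd n" using I(2) by (simp add: n_def)
    then obtain m where m: "n = a i * m" by blast
    have ai: "a i > 0" "x \<le> real_of_int (a i)" using aA I(2) pos x by auto
    have m0: "m > 0" using n ai(1) m by (simp add: zero_less_mult_iff)
    have "x * real_of_int m \<le> real_of_int (a i) * real_of_int m"
      using ai m0 by (intro mult_right_mono) auto
    also have "\<dots> \<le> L" using le m by (simp add: n_def)
    finally have "real_of_int m \<le> L / x" using x by (simp add: field_simps)
    then have "(a i, m) \<in> B"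
      using m0 le m aA[OF I(2)] by (auto simp: B_def n_def le_floor_iff)
    moreover have "a \<in> F (a i, m)"
      using aA pos ext by (auto simp: F_def PiE_def n_def simp flip: m)
    ultimately show "a \<in> (\<Union>z\<in>B. F z)" by blast
  qed
  moreover have "finite (\<Union>z\<in>B. F z)"
    using finB I(1) posB by (auto simp: F_def intro!: finite_PiE card_pos_int_divisors(1))
  ultimately have "card S \<le> (\<Sum>z\<in>B. card (F z))"
    by (intro order_trans[OF card_mono card_UN_le[OF finB]])
  then have "real (card S) \<le> (\<Sum>z\<in>B. real (card (F z)))"
    by (simp flip: of_nat_sum)
  also have "\<dots> \<le> real (card B) * D ^ card I"
  proof (rule sum_bounded_above)
    fix z assume "z \<in> B"
    obtain b m where z: "z = (b, m)" by (cases z)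
    have pz: "b * m > 0" using posB \<open>z \<in> B\<close> z by simp
    have le: "real_of_int (b * m) \<le> L" using \<open>z \<in> B\<close> z by (auto simp: B_def)
    have "real (card (F z)) = real (card {d. d dvd nat (b * m)}) ^ card I"
      using I(1) card_pos_int_divisors(2)[OF pz] by (simp add: F_def z card_PiE)
    also have "\<dots> \<le> D ^ card I"
      using D[of "nat (b * m)"] pz le by (intro power_mono) auto
    finally show "real (card (F z)) \<le> D ^ card I" .
  qed
  also have "\<dots> \<le> real (card (A i)) * (L / x) * D ^ card I"
  proof (intro mult_right_mono)
    have "card B \<le> card (A i \<times> {1..\<lfloor>L / x\<rfloor>})"
      unfolding B_def using fin by (intro card_mono) auto
    then have "real (card B) \<le> real (card (A i)) * real (nat \<lfloor>L / x\<rfloor>)"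
      by (simp add: card_cartesian_product flip: of_nat_mult)
    also have "\<dots> \<le> real (card (A i)) * (L / x)"
      using L x by (intro mult_left_mono) auto
    finally show "real (card B) \<le> real (card (A i)) * (L / x)" .
  qed (use \<open>D \<ge> 0\<close> in simp)
  finally show ?thesis by (simp add: S_def)
qed

theorem theorem1p5:
  fixes k :: nat and \<epsilon> :: real
  assumes "k \<ge> 2" and "0 < \<epsilon>" and "\<epsilon> < 1"
  shows "\<exists>C::real. C > 0 \<and>
    (\<forall>(X :: nat \<Rightarrow> real) (L :: real) (\<delta> :: real) (A :: nat \<Rightarrow> int set).
      (\<forall>i\<in>{1..k}. X i \<ge> 1) \<longrightarrow>
      L \<ge> 1 \<longrightarrow>
      L \<ge> Max (X ` {1..k}) \<longrightarrow>
      0 < \<delta> \<longrightarrow> \<delta> \<le> 1 \<longrightarrow>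
      (\<forall>i\<in>{1..k}. real_of_int ` A i \<subseteq> {X i..2 * X i}) \<longrightarrow>
      real (card {a \<in> PiE {1..k} A. real_of_int (Lcm (a ` {1..k})) \<le> L})
        \<ge> \<delta> * (\<Prod>i=1..k. real (card (A i))) \<longrightarrow>
      (\<Prod>i=1..k. real (card (A i)))
        \<le> C * \<delta> powr (- (real k / (real k - 1)))
            * (L powr (real k / (real k - 1) + \<epsilon>)
               / (\<Prod>i=1..k. X i) powr (1 / (real k - 1))))"
proof -
  define r where "r = 1 / (real k - 1)"
  have r: "r > 0" "(real k - 1) * r = 1" "real k / (real k - 1) = real k * r"
    using assms(1) by (auto simp: r_def)
  \<comment> \<open>Each of the \<open>k\<close> counts carries \<open>D ^ k\<close> with
    \<open>D = c * L powr \<eta>\<close>. After the power \<open>r\<close> the total loss is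
    \<open>L powr (k * k * \<eta> * r)\<close>, which this choice makes
    \<open>L powr \<epsilon>\<close>; the same exponent \<open>k * k * r\<close> on \<open>c\<close>
    gives \<open>C\<close>.\<close>
  define \<eta> where "\<eta> = \<epsilon> / (real k * real k * r)"
  have \<eta>: "\<eta> > 0" "real k * (1 + real k * \<eta>) * r = real k * r + \<epsilon>"
    using assms r(1) by (auto simp: \<eta>_def field_simps)
  obtain c :: real where c: "c \<ge> 1"
    "\<And>n::nat. n > 0 \<Longrightarrow> real (card {d. d dvd n}) \<le> c * real n powr \<eta>"
    using divisor_bound[OF \<eta>(1)] by blast
  define C where "C = c powr (real k * real k * r)"
  have main: "(\<Prod>i=1..k. real (card (A i)))
        \<le> C * \<delta> powr (- (real k * r)) * (L powr (real k * r + \<epsilon>) / (\<Prod>i=1..k. X i) powr r)"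
    if X: "\<And>i. i \<in> {1..k} \<Longrightarrow> X i \<ge> 1" and L: "L \<ge> 1" and d: "\<delta> > 0"
      and A: "\<And>i. i \<in> {1..k} \<Longrightarrow> real_of_int ` A i \<subseteq> {X i..2 * X i}"
      and ge: "\<delta> * (\<Prod>i=1..k. real (card (A i))) \<le>
        real (card {a \<in> PiE {1..k} A. real_of_int (Lcm (a ` {1..k})) \<le> L})"
    for X L \<delta> and A :: "nat \<Rightarrow> int set"
  proof -
    define P where "P = (\<Prod>i=1..k. real (card (A i)))"
    define Q where "Q = (\<Prod>i=1..k. X i)"
    define D where "D = c * L powr \<eta>"
    have D: "D > 0" using c(1) L by (simp add: D_def)
    have Q: "Q > 0" unfolding Q_def using X by (intro prod_pos) force
    have Ai: "X i \<le> real_of_int a" "real_of_int a \<le> 2 * X i" if "i \<in> {1..k}" "a \<in> A i" for i a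
      using A that by fastforce+
    \<comment> \<open>An infinite set would have \<open>card\<close> equal to 0, so the count needs
      the interval to be bounded on both sides.\<close>
    have fin: "finite (A i)" if "i \<in> {1..k}" for i
    proof (rule finite_subset)
      show "A i \<subseteq> {\<lfloor>X i\<rfloor>..\<lfloor>2 * X i\<rfloor>}"
      proof
        fix a assume "a \<in> A i"
        then show "a \<in> {\<lfloor>X i\<rfloor>..\<lfloor>2 * X i\<rfloor>}"
          using Ai[OF that \<open>a \<in> A i\<close>] by (simp add: le_floor_iff) linarith
      qed
    qed simp
    show ?thesis
    \<comment> \<open>The later cancellation of \<open>P\<close> requires \<open>P > 0\<close>; for
      \<open>P = 0\<close> the right-hand side is nonnegative.\<close>
    proof (cases "P = 0")
      case True
      then show ?thesis unfolding P_def[symmetric] by (simp add: C_def)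
    next
      case False
      moreover have "P \<ge> 0" unfolding P_def by (intro prod_nonneg) auto
      ultimately have P: "P > 0" by simp
      have bound: "\<delta> * P \<le> real (card (A i)) * (L / X i) * D ^ k" if i: "i \<in> {1..k}" for i
      proof -
        have "real (card {a \<in> PiE {1..k} A. real_of_int (Lcm (a ` {1..k})) \<le> L})
            \<le> real (card (A i)) * (L / X i) * D ^ card {1..k}"
        proof (rule card_Lcm_le_tuples)
          show "a > 0" if "j \<in> {1..k}" "a \<in> A j" for j a
            using Ai(1)[OF that] X[OF that(1)] by linarith
          show "real (card {d. d dvd n}) \<le> D" if "n > 0" "real n \<le> L" for n
          proof -
            have "c * real n powr \<eta> \<le> D"
              unfolding D_def using that c(1) \<eta>(1) by (intro mult_left_mono powr_mono2) auto
            then show ?thesis using c(2)[OF that(1)] by linarith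
          qed
        qed (use i fin Ai X[OF i] L D in auto)
        then show ?thesis using ge by (simp add: P_def)
      qed
      have "(\<delta> * P) ^ k = (\<Prod>i=1..k. \<delta> * P)" by simp
      also have "\<dots> \<le> (\<Prod>i=1..k. real (card (A i)) * (L / X i) * D ^ k)"
        using bound d P by (intro prod_mono) auto
      also have "\<dots> = P * (L * D ^ k) ^ k / Q"
        by (simp add: prod.distrib prod_dividef P_def Q_def power_mult_distrib)
      \<comment> \<open>The cardinalities on the right multiply to a single \<open>P\<close>, which
        is split off on the left as well.\<close>
      finally have "\<delta> ^ k * P ^ (k - 1) * P \<le> ((L * D ^ k) ^ k / Q) * P"
        using assms(1) by (simp add: power_mult_distrib power_eq_if[of P k] mult_ac)
      then have "\<delta> ^ k * P ^ (k - 1) \<le> (L * D ^ k) ^ k / Q"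
        using P by (rule mult_right_le_imp_le)
      then have "P ^ (k - 1) \<le> (L * D ^ k) ^ k / Q / \<delta> ^ k"
        using d by (subst pos_le_divide_eq) (simp_all add: mult.commute)
      then have "(P ^ (k - 1)) powr r \<le> ((L * D ^ k) ^ k / Q / \<delta> ^ k) powr r"
        using P r(1) by (intro powr_mono2) auto
      \<comment> \<open>Here \<open>(k - 1) * r = 1\<close>, so the power \<open>r\<close> is the
        \<open>(k - 1)\<close>-th root.\<close>
      moreover have "(P ^ (k - 1)) powr r = P"
        using P assms(1) r(2) by (simp add: powr_powr flip: powr_realpow)
      moreover have "((L * D ^ k) ^ k / Q / \<delta> ^ k) powr r
          = C * \<delta> powr (- (real k * r)) * (L powr (real k * r + \<epsilon>) / Q powr r)"
      proof -
        have "(L * D ^ k) ^ k = (c powr real k * L powr (1 + real k * \<eta>)) powr real k"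
          using c(1) L by (simp add: D_def powr_realpow powr_add powr_powr power_mult_distrib
              powr_power mult_ac)
        also have "\<dots> = c powr (real k * real k) * L powr (real k * (1 + real k * \<eta>))"
          using c(1) L by (simp add: powr_mult powr_powr mult_ac)
        finally have "((L * D ^ k) ^ k) powr r = C * L powr (real k * r + \<epsilon>)"
          using c(1) L by (simp add: powr_mult powr_powr C_def \<eta>(2))
        moreover have "(\<delta> ^ k) powr r = \<delta> powr (real k * r)"
          using d by (simp add: powr_powr flip: powr_realpow)
        ultimately show ?thesis
          using d Q L D by (simp add: powr_divide powr_mult powr_minus divide_simps mult_ac)
      qed
      ultimately show ?thesis unfolding P_def[symmetric] Q_def[symmetric] by simp
    qed
  qed
  have "C > 0" using c(1) by (simp add: C_def)
  then show ?thesis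
    unfolding r(3) r_def[symmetric]
    by (intro exI[of _ C] conjI allI impI main) blast+
qed

end
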